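(* Let $\{S_m\}_{m\in\mathcal{M}}$ be a finite or countable family of D-models in $(\mathcal{Q}_\lambda,H)$ with respective parameters $\eta_m$, $D_m$ and $B'$ such that $$D_m\ge\tfrac12\ \text{ and }\ \eta_m^2\ge\frac{84D_m}{5}\ \text{ for all } m\in\mathcal{M},\qquad\sum_{m\in\mathcal{M}}\exp\left[-\eta_m^2/84\right]=\Sigma<+\infty.$$ Set $S=\bigcup_{m\in\mathcal{M}}S_m$ and, for $t\in S$, $\eta(t)=\inf\{\eta_m : m\in\mathcal{M},\ S_m\ni t\}$. Given two distinct points $t,u\in S$ there exists a test $\psi_{t,u}$ between $t$ and $u$ which satisfies $$\sup_{\{\mu\in\mathcal{Q}_+(\mathcal{X}) : H(\mu,\mu_t)\le H(t,u)/4\}}\mathbb{P}_\mu[\psi_{t,u}(\boldsymbol{X})=u]\le\exp\left[-\left(H^2(t,u)-\eta^2(t)+\eta^2(u)\right)/4\right],$$ $$\sup_{\{\mu\in\mathcal{Q}_+(\mathcal{X}) : H(\mu,\mu_u)\le H(t,u)/4\}}\mathbb{P}_\mu[\psi_{t,u}(\boldsymbol{X})=t]\le\exp\left[-\left(H^2(t,u)-\eta^2(u)+\eta^2(t)\right)/4\right],$$ and, for all $\mu\in\mathcal{Q}_+(\mathcal{X})$, $$\mathbb{P}_\mu[\psi_{t,u}(\boldsymbol{X})=u]\le\exp\left[\left(16H^2(\mu,\mu_t)+\eta^2(t)-\eta^2(u)\right)/4\right].$$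
   Context: $(\mathcal{X},\mathcal{E})$ is a measurable space, $\mathcal{Q}_+(\mathcal{X})$ the set of finite positive measures on it, $\lambda$ a positive reference measure on $\mathcal{X}$. A Poisson process with mean measure $\mu\in\mathcal{Q}_+(\mathcal{X})$ is a point process $\boldsymbol{X}=\{X_1,\dots,X_N\}$ such that $N$ is Poisson with parameter $\mu(\mathcal{X})$ and, conditionally on $N$, the $X_i$ are i.i.d. with distribution $\mu/\mu(\mathcal{X})$. $\mathbb{P}_\mu$ is probability when $\boldsymbol{X}$ is a Poisson process with mean measure $\mu$. For $\mu,\mu'\in\mathcal{Q}_+(\mathcal{X})$, $H^2(\mu,\mu')=\frac12\int(\sqrt{d\mu/d\nu}-\sqrt{d\mu'/d\nu})^2d\nu$ for any measure $\nu$ dominating both. $\mathbb{L}_1^+(\lambda)$ is the set of nonnegative elements of $\mathbb{L}_1(\lambda)$; $\mu_t=t\cdot\lambda$; $\mathcal{Q}_\lambda=\{\mu_t : t\in\mathbb{L}_1^+(\lambda)\}$ is identified with $\mathbb{L}_1^+(\lambda)$ via $t\mapsto\mu_t$, and $H(t,u)=H(\mu_t,\mu_u)$. D-model: a subset $S'$ of a metric space $(M,d)$ is a D-model with parameters $\eta,D,B'>0$ if $|S'\cap\mathcal{B}(t,x\eta)|\le B'\exp[Dx^2]$ for all $x\ge2$ and $t\in M$, where $\mathcal{B}(t,r)$ is the open ball of center $t$ and radius $r$ in $M$. A test between two distinct points $t,u\in\mathcal{Q}_\lambda$ is a measurable function $\psi_{t,u}(\boldsymbol{X})$ of $\boldsymbol{X}$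 with values in $\{t,u\}$. *)

theory Defs
  imports "HOL-Probability.Probability"
begin

text \<open>
  A measurable space is given by any measure carrying it; here the reference measure
  \<open>\<lambda>\<close> plays this role, so that only \<open>space \<lambda>\<close> and \<open>sets \<lambda>\<close> matter in \<open>Q_plus \<lambda>\<close>.
\<close>

definition Q_plus :: "'a measure \<Rightarrow> 'a measure set" where
  "Q_plus M = {\<mu>. sets \<mu> = sets M \<and> finite_measure \<mu>}"

text \<open>
  The points of \<open>Q_dens \<lambda>\<close> are the measures \<open>t \<cdot> \<lambda>\<close> themselves. Two nonnegative integrable
  functions give the same point iff they agree \<open>\<lambda>\<close>-almost everywhere, so this is also the
  set of nonnegative elements of \<open>L\<^sub>1(\<lambda>)\<close>, with the quotient by a.e. equality built in.
\<close>

definition Q_dens :: "'a measure \<Rightarrow> 'a measure set" where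
  "Q_dens lam =
     {density lam (\<lambda>x. ennreal (t x)) | t :: 'a \<Rightarrow> real.
        integrable lam t \<and> (\<forall>x\<in>space lam. 0 \<le> t x)}"

definition sum_measure :: "'a measure \<Rightarrow> 'a measure \<Rightarrow> 'a measure" where
  "sum_measure \<mu> \<mu>' = measure_of (space \<mu>) (sets \<mu>) (\<lambda>A. emeasure \<mu> A + emeasure \<mu>' A)"

text \<open>
  The dominating measure is taken to be \<open>\<mu> + \<mu>'\<close>; \<open>hellinger_sq_eq\<close> below shows that any
  other dominating measure gives the same value.
\<close>

definition hellinger_sq :: "'a measure \<Rightarrow> 'a measure \<Rightarrow> real" where
  "hellinger_sq \<mu> \<mu>' =
     (let \<nu> = sum_measure \<mu> \<mu>' in
      1 / 2 * (\<integral>x. (sqrt (enn2real (RN_deriv \<nu> \<mu> x)) - sqrt (enn2real (RN_deriv \<nu> \<mu>' x)))\<^sup>2 \<partial>\<nu>))"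

definition hellinger :: "'a measure \<Rightarrow> 'a measure \<Rightarrow> real" where
  "hellinger \<mu> \<mu>' = sqrt (hellinger_sq \<mu> \<mu>')"

lemma space_sum_measure [simp]: "space (sum_measure \<mu> \<mu>') = space \<mu>"
  and sets_sum_measure [simp]: "sets (sum_measure \<mu> \<mu>') = sets \<mu>"
  by (simp_all add: sum_measure_def)

lemma emeasure_sum_measure:
  assumes "sets \<mu>' = sets \<mu>" "A \<in> sets \<mu>"
  shows "emeasure (sum_measure \<mu> \<mu>') A = emeasure \<mu> A + emeasure \<mu>' A"
proof (rule emeasure_measure_of[OF sum_measure_def])
  show "sets \<mu> \<subseteq> Pow (space \<mu>)" by (rule sets.space_closed)
  show "A \<in> sets (sum_measure \<mu> \<mu>')" using assms by simp
  show "positive (sets (sum_measure \<mu> \<mu>')) (\<lambda>A. emeasure \<mu> A + emeasure \<mu>' A)"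
    by (simp add: positive_def)
  show "countably_additive (sets (sum_measure \<mu> \<mu>')) (\<lambda>A. emeasure \<mu> A + emeasure \<mu>' A)"
  proof (rule countably_additiveI)
    fix A :: "nat \<Rightarrow> 'a set"
    assume A: "range A \<subseteq> sets (sum_measure \<mu> \<mu>')" "disjoint_family A"
    then have "(\<Sum>i. emeasure \<mu> (A i)) = emeasure \<mu> (\<Union>i. A i)"
      and "(\<Sum>i. emeasure \<mu>' (A i)) = emeasure \<mu>' (\<Union>i. A i)"
      using assms by (auto intro!: suminf_emeasure)
    then show "(\<Sum>i. emeasure \<mu> (A i) + emeasure \<mu>' (A i))
        = emeasure \<mu> (\<Union>i. A i) + emeasure \<mu>' (\<Union>i. A i)"
      by (simp add: suminf_add[symmetric])
  qed
qed

lemma hellinger_sq_eq: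
  assumes sets_eq: "sets \<mu>' = sets \<mu>"
    and fin: "finite_measure \<mu>" "finite_measure \<mu>'"
    and f: "f \<in> borel_measurable \<nu>" "density \<nu> f = \<mu>"
    and g: "g \<in> borel_measurable \<nu>" "density \<nu> g = \<mu>'"
  shows "hellinger_sq \<mu> \<mu>' =
    1 / 2 * (\<integral>x. (sqrt (enn2real (f x)) - sqrt (enn2real (g x)))\<^sup>2 \<partial>\<nu>)"
proof -
  define \<rho> where "\<rho> = sum_measure \<mu> \<mu>'"
  note [measurable] = f(1) g(1)
  have sets_\<nu>: "sets \<nu> = sets \<mu>" and space_\<nu>: "space \<nu> = space \<mu>"
    using f(2) by auto
  have em: "emeasure \<rho> A = emeasure \<mu> A + emeasure \<mu>' A" if "A \<in> sets \<mu>" for A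
    unfolding \<rho>_def using emeasure_sum_measure[OF sets_eq that] .
  have sets_\<rho>: "sets \<rho> = sets \<mu>" by (simp add: \<rho>_def)
  have space_\<rho>: "space \<rho> = space \<mu>" by (simp add: \<rho>_def)
  interpret \<mu>: finite_measure \<mu> by fact
  interpret \<mu>': finite_measure \<mu>' by fact
  interpret \<rho>: finite_measure \<rho>
  proof
    show "emeasure \<rho> (space \<rho>) \<noteq> \<infinity>"
      using em[of "space \<mu>"] \<mu>.emeasure_finite[of "space \<mu>"] \<mu>'.emeasure_finite[of "space \<mu>"]
      by (simp add: space_\<rho>)
  qed
  have \<rho>_eq: "density \<nu> (\<lambda>x. f x + g x) = \<rho>"
  proof (rule measure_eqI)
    show "sets (density \<nu> (\<lambda>x. f x + g x)) = sets \<rho>"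
      by (simp add: sets_\<nu> sets_\<rho>)
    fix A assume "A \<in> sets (density \<nu> (\<lambda>x. f x + g x))"
    then have A: "A \<in> sets \<nu>" by simp
    have "emeasure (density \<nu> (\<lambda>x. f x + g x)) A
        = emeasure (density \<nu> f) A + emeasure (density \<nu> g) A"
      using A by (simp add: emeasure_density distrib_right nn_integral_add)
    then show "emeasure (density \<nu> (\<lambda>x. f x + g x)) A = emeasure \<rho> A"
      using A em f(2) g(2) sets_\<nu> by simp
  qed
  have ac: "absolutely_continuous \<rho> \<mu>" "absolutely_continuous \<rho> \<mu>'"
    using em by (auto simp: absolutely_continuous_def null_sets_def sets_\<rho> sets_eq)
  define p where "p = RN_deriv \<rho> \<mu>"
  define q where "q = RN_deriv \<rho> \<mu>'"
  have p_mp: "p \<in> borel_measurable \<rho>" and q_mp: "q \<in> borel_measurable \<rho>"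
    by (simp_all add: p_def q_def)
  have [measurable]: "p \<in> borel_measurable \<nu>" "q \<in> borel_measurable \<nu>"
    using p_mp q_mp measurable_cong_sets[OF sets_\<rho> refl] measurable_cong_sets[OF sets_\<nu> refl]
    by auto
  have dp: "density \<rho> p = \<mu>" and dq: "density \<rho> q = \<mu>'"
    unfolding p_def q_def using ac sets_\<rho> sets_eq by (auto intro!: \<rho>.density_RN_deriv)
  have "density \<nu> (\<lambda>x. (f x + g x) * p x) = density \<nu> f"
    using dp f(2) \<rho>_eq by (simp add: density_density_eq[symmetric])
  moreover have int_f: "integral\<^sup>N \<nu> f \<noteq> \<infinity>"
  proof -
    have "emeasure \<mu> (space \<nu>) = integral\<^sup>N \<nu> f"
      unfolding f(2)[symmetric] by (auto simp: emeasure_density intro!: nn_integral_cong)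
    then show ?thesis using \<mu>.emeasure_finite[of "space \<nu>"] by simp
  qed
  ultimately have AE_f: "AE x in \<nu>. f x = (f x + g x) * p x"
    by (subst finite_density_unique[symmetric]) auto
  have "density \<nu> (\<lambda>x. (f x + g x) * q x) = density \<nu> g"
    using dq g(2) \<rho>_eq by (simp add: density_density_eq[symmetric])
  moreover have int_g: "integral\<^sup>N \<nu> g \<noteq> \<infinity>"
  proof -
    have "emeasure \<mu>' (space \<nu>) = integral\<^sup>N \<nu> g"
      unfolding g(2)[symmetric] by (auto simp: emeasure_density intro!: nn_integral_cong)
    then show ?thesis using \<mu>'.emeasure_finite[of "space \<nu>"] by simp
  qed
  ultimately have AE_g: "AE x in \<nu>. g x = (f x + g x) * q x"
    by (subst finite_density_unique[symmetric]) auto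
  define s where "s x = enn2real (f x + g x)" for x
  have [measurable]: "s \<in> borel_measurable \<nu>" unfolding s_def[abs_def] by measurable
  have AE_fin: "AE x in \<nu>. f x \<noteq> \<infinity>" "AE x in \<nu>. g x \<noteq> \<infinity>"
    using nn_integral_PInf_AE[OF f(1) int_f] nn_integral_PInf_AE[OF g(1) int_g] .
  have "density \<nu> (\<lambda>x. ennreal (s x)) = \<rho>"
    unfolding \<rho>_eq[symmetric]
  proof (rule density_cong)
    show "AE x in \<nu>. ennreal (s x) = f x + g x"
      using AE_fin by eventually_elim (simp add: s_def ennreal_enn2real_if)
  qed (auto simp: s_def)
  then have "(\<integral>x. (sqrt (enn2real (p x)) - sqrt (enn2real (q x)))\<^sup>2 \<partial>\<rho>)
      = (\<integral>x. (sqrt (enn2real (p x)) - sqrt (enn2real (q x)))\<^sup>2 \<partial>density \<nu> (\<lambda>x. ennreal (s x)))"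
    by simp
  also have "\<dots> = (\<integral>x. s x * (sqrt (enn2real (p x)) - sqrt (enn2real (q x)))\<^sup>2 \<partial>\<nu>)"
    by (subst integral_density) (auto simp: s_def)
  also have "\<dots> = (\<integral>x. (sqrt (enn2real (f x)) - sqrt (enn2real (g x)))\<^sup>2 \<partial>\<nu>)"
  proof (rule integral_cong_AE)
    show "AE x in \<nu>. s x * (sqrt (enn2real (p x)) - sqrt (enn2real (q x)))\<^sup>2
        = (sqrt (enn2real (f x)) - sqrt (enn2real (g x)))\<^sup>2"
      using AE_f AE_g
    proof eventually_elim
      case (elim x)
      have "enn2real (f x) = s x * enn2real (p x)" "enn2real (g x) = s x * enn2real (q x)"
        using elim enn2real_mult[of "f x + g x" "p x"] enn2real_mult[of "f x + g x" "q x"]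
        by (simp_all add: s_def)
      moreover have "0 \<le> s x" by (simp add: s_def)
      ultimately show ?case
        by (simp add: real_sqrt_mult right_diff_distrib[symmetric] power_mult_distrib)
    qed
  qed (auto simp: s_def)
  finally show ?thesis
    by (simp add: hellinger_sq_def Let_def p_def q_def \<rho>_def)
qed

text \<open>
  A realization \<open>{X\<^sub>1, \<dots>, X\<^sub>N}\<close> is a finite multiset, since points repeat with positive
  probability when the mean measure has atoms. The sigma-algebra is the usual one for point
  processes: it is generated by the counting variables \<open>N(A)\<close>, the number of points in a
  measurable set \<open>A\<close>.
\<close>

definition point_configs :: "'a measure \<Rightarrow> 'a multiset measure" where
  "point_configs M =
     sigma {X. set_mset X \<subseteq> space M}
       {{X. set_mset X \<subseteq> space M \<and> size (filter_mset (\<lambda>x. x \<in> A) X) = k} | A k. A \<in> sets M}"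

text \<open>The library's \<open>poisson_pmf\<close> is specified for positive rates only.\<close>

definition poisson_nat :: "real \<Rightarrow> nat pmf" where
  "poisson_nat r = (if r = 0 then return_pmf 0 else poisson_pmf r)"

text \<open>
  The law of a Poisson process with mean measure \<open>\<mu>\<close>: draw \<open>N\<close>, then \<open>N\<close> independent points
  from \<open>\<mu> / \<mu>(space \<mu>)\<close>. If \<open>\<mu> = 0\<close> then \<open>N = 0\<close> almost surely and the (meaningless)
  normalization plays no role. Probabilities of events under this law are the
  \<open>\<P>\<^sub>\<mu>\<close>-probabilities of events that depend on the process only.
\<close>

definition poisson_process :: "'a measure \<Rightarrow> 'a multiset measure" where
  "poisson_process \<mu> =
     bind (measure_pmf (poisson_nat (measure \<mu> (space \<mu>))))
       (\<lambda>n. distr (PiM {..<n} (\<lambda>_. scale_measure (1 / emeasure \<mu> (space \<mu>)) \<mu>))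
              (point_configs \<mu>) (\<lambda>\<omega>. mset (map \<omega> [0..<n])))"

lemma space_point_configs: "space (point_configs M) = {X. set_mset X \<subseteq> space M}"
  unfolding point_configs_def by (subst space_measure_of) auto

lemma point_configs_cong: "sets M = sets M' \<Longrightarrow> point_configs M = point_configs M'"
  using sets_eq_imp_space_eq[of M M'] by (simp add: point_configs_def)

lemma measurable_point_configs_mset:
  assumes "sets P = sets M"
  shows "(\<lambda>\<omega>. mset (map \<omega> [0..<n])) \<in> measurable (PiM {..<n} (\<lambda>_. P)) (point_configs M)"
  unfolding point_configs_def
proof (rule measurable_measure_of)
  have sp: "space P = space M" using assms by (rule sets_eq_imp_space_eq)
  have mem: "set_mset (mset (map \<omega> [0..<n])) \<subseteq> space M"
    if "\<omega> \<in> space (PiM {..<n} (\<lambda>_. P))" for \<omega>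
  proof -
    have "\<omega> i \<in> space M" if "i < n" for i
      using PiE_mem[of \<omega> "{..<n}" "\<lambda>_. space P" i] that \<open>\<omega> \<in> _\<close> sp by (simp add: space_PiM)
    then show ?thesis by auto
  qed
  show "(\<lambda>\<omega>. mset (map \<omega> [0..<n])) \<in> space (PiM {..<n} (\<lambda>_. P)) \<rightarrow> {X. set_mset X \<subseteq> space M}"
    using mem by blast
  fix Y assume "Y \<in> {{X. set_mset X \<subseteq> space M \<and> size (filter_mset (\<lambda>x. x \<in> A) X) = k} | A k.
    A \<in> sets M}"
  then obtain A k where A: "A \<in> sets P"
    and Y: "Y = {X. set_mset X \<subseteq> space M \<and> size (filter_mset (\<lambda>x. x \<in> A) X) = k}"
    using assms by auto
  note [measurable] = A
  have count: "size (filter_mset (\<lambda>x. x \<in> A) (mset (map \<omega> [0..<n])))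
      = (\<Sum>i<n. if \<omega> i \<in> A then 1 else 0)" for \<omega> :: "nat \<Rightarrow> 'a"
    by (induction n) auto
  have "(\<lambda>\<omega>. mset (map \<omega> [0..<n])) -` Y \<inter> space (PiM {..<n} (\<lambda>_. P))
      = {\<omega> \<in> space (PiM {..<n} (\<lambda>_. P)).
          size (filter_mset (\<lambda>x. x \<in> A) (mset (map \<omega> [0..<n]))) = k}"
    using mem unfolding Y by blast
  also have "\<dots> \<in> sets (PiM {..<n} (\<lambda>_. P))"
    unfolding count by measurable
  finally show "(\<lambda>\<omega>. mset (map \<omega> [0..<n])) -` Y \<inter> space (PiM {..<n} (\<lambda>_. P))
      \<in> sets (PiM {..<n} (\<lambda>_. P))" .
qed auto

lemma
  shows space_poisson_process: "space (poisson_process \<mu>) = space (point_configs \<mu>)"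
    and sets_poisson_process: "sets (poisson_process \<mu>) = sets (point_configs \<mu>)"
  by (simp_all add: poisson_process_def)

lemma prob_space_poisson_process:
  assumes "finite_measure \<mu>"
  shows "prob_space (poisson_process \<mu>)"
proof -
  interpret finite_measure \<mu> by fact
  define c where "c = emeasure \<mu> (space \<mu>)"
  define P where "P = scale_measure (1 / c) \<mu>"
  define K where "K n = distr (PiM {..<n} (\<lambda>_. P)) (point_configs \<mu>) (\<lambda>\<omega>. mset (map \<omega> [0..<n]))"
    for n :: nat
  have sets_P: "sets P = sets \<mu>" and space_P: "space P = space \<mu>"
    by (simp_all add: P_def space_scale_measure)
  have meas: "(\<lambda>\<omega>. mset (map \<omega> [0..<n])) \<in> measurable (PiM {..<n} (\<lambda>_. P)) (point_configs \<mu>)" for n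
    by (rule measurable_point_configs_mset[OF sets_P])
  have c_fin: "c \<noteq> \<infinity>" unfolding c_def by simp
  have em_P: "emeasure P (space P) = (if c = 0 then 0 else 1)"
    using c_fin by (simp add: P_def space_scale_measure c_def[symmetric] ennreal_divide_times
        ennreal_divide_self top.not_eq_extremum)
  interpret P: finite_measure P
    by standard (simp add: em_P)
  have em_K: "emeasure (K n) (space (K n)) = (if c = 0 then 0 else 1) ^ n" for n
  proof -
    interpret product_sigma_finite "\<lambda>_::nat. P" by standard
    have "emeasure (K n) (space (K n)) = emeasure (PiM {..<n} (\<lambda>_. P)) (space (PiM {..<n} (\<lambda>_. P)))"
      unfolding K_def space_distr emeasure_distr[OF meas sets.top]
      using measurable_space[OF meas] by (intro arg_cong2[where f = emeasure]) auto
    also have "\<dots> = (\<Prod>i<n. emeasure P (space P))"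
      unfolding space_PiM by (rule emeasure_PiM) auto
    finally show ?thesis by (simp add: em_P)
  qed
  have ne: "space (point_configs \<mu>) \<noteq> {}"
    unfolding space_point_configs by (auto intro!: exI[of _ "{#}"])
  have K: "K \<in> measurable (measure_pmf p) (subprob_algebra (point_configs \<mu>))" for p
  proof -
    have "emeasure (K n) (space (K n)) \<le> 1" for n
      unfolding em_K by (simp add: power_0_left)
    moreover have "space (K n) \<noteq> {}" for n
      using ne by (simp add: K_def)
    ultimately have "subprob_space (K n)" for n
      by (rule subprob_spaceI)
    then show ?thesis
      by (auto simp: space_subprob_algebra K_def)
  qed
  have "prob_space (measure_pmf (poisson_nat (measure \<mu> (space \<mu>))) \<bind> K)"
  proof (rule prob_spaceI)
    let ?p = "poisson_nat (measure \<mu> (space \<mu>))"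
    have AE1: "AE n in measure_pmf ?p. emeasure (K n) (space (point_configs \<mu>)) = 1"
    proof (cases "c = 0")
      case True
      then have "?p = return_pmf 0"
        by (simp add: poisson_nat_def c_def measure_def)
      then show ?thesis
        using em_K[of 0] by (simp add: AE_measure_pmf_iff K_def)
    next
      case False
      then show ?thesis using em_K by (simp add: K_def)
    qed
    have "emeasure (measure_pmf ?p \<bind> K) (space (point_configs \<mu>))
        = (\<integral>\<^sup>+n. emeasure (K n) (space (point_configs \<mu>)) \<partial>measure_pmf ?p)"
      by (rule emeasure_bind[OF _ K]) auto
    also have "\<dots> = (\<integral>\<^sup>+n. 1 \<partial>measure_pmf ?p)"
      using AE1 by (rule nn_integral_cong_AE)
    finally show "emeasure (measure_pmf ?p \<bind> K) (space (measure_pmf ?p \<bind> K)) = 1"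
      by (simp add: K_def)
  qed
  then show ?thesis
    unfolding poisson_process_def K_def[abs_def] P_def c_def .
qed

text \<open>Finiteness is required explicitly because \<open>card\<close> is \<open>0\<close> on infinite sets.\<close>

definition D_model ::
  "'p set \<Rightarrow> ('p \<Rightarrow> 'p \<Rightarrow> real) \<Rightarrow> 'p set \<Rightarrow> real \<Rightarrow> real \<Rightarrow> real \<Rightarrow> bool" where
  "D_model M d S \<eta> D B \<longleftrightarrow>
     S \<subseteq> M \<and> 0 < \<eta> \<and> 0 < D \<and> 0 < B \<and>
     (\<forall>x\<ge>2. \<forall>t\<in>M. finite (S \<inter> {s\<in>M. d t s < x * \<eta>}) \<and>
        real (card (S \<inter> {s\<in>M. d t s < x * \<eta>})) \<le> B * exp (D * x\<^sup>2))"

definition is_test :: "'a measure \<Rightarrow> 'b \<Rightarrow> 'b \<Rightarrow> ('a multiset \<Rightarrow> 'b) \<Rightarrow> bool" where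
  "is_test M t u \<psi> \<longleftrightarrow> \<psi> \<in> measurable (point_configs M) (count_space {t, u})"

definition eta_at :: "'i set \<Rightarrow> ('i \<Rightarrow> 'p set) \<Rightarrow> ('i \<Rightarrow> real) \<Rightarrow> 'p \<Rightarrow> real" where
  "eta_at I S \<eta> t = Inf (\<eta> ` {m\<in>I. t \<in> S m})"

end

theory Submission
  imports Defs
begin

text \<open>
  Write \<open>a = \<surd>dt\<close>, \<open>b = \<surd>du\<close> and \<open>m = \<surd>d\<mu>\<close>, the densities being taken with respect to a common
  dominating measure. A likelihood ratio test between \<open>t\<close> and \<open>u\<close> is not robust, because
  \<open>b / a\<close> is unbounded. The idea is to pull both square roots a quarter of the way towards each
  other: the segment from \<open>a\<close> to \<open>b\<close> in \<open>L\<^sub>2\<close> contains \<open>(3 a + b) / 4\<close> and \<open>(a + 3 b) / 4\<close>, and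
  their ratio \<open>r = (a + 3 b) / (3 a + b)\<close> lies between \<open>1/3\<close> and \<open>3\<close>. The test chooses \<open>u\<close> when
  the statistic \<open>T(X) = \<Sum>\<^sub>i ln r(X\<^sub>i)\<close> is large.

  For a Poisson process, \<open>E\<^sub>\<mu> exp (\<Sum>\<^sub>i \<phi>(X\<^sub>i)) = exp (\<integral>(e\<^sup>\<phi> - 1) d\<mu>)\<close>
  (\<open>poisson_process_exp_moment\<close>), so by Chernoff's inequality the errors are governed by
  \<open>\<integral>(r - 1) d\<mu> = \<integral>(r - 1) m\<^sup>2\<close>. Completing the square in \<open>m\<close> gives the pointwise identity
  \<open>tilting_identity\<close>, whose right-hand side \<open>(r - 3) (m - (3 a + b) / 4)\<^sup>2\<close> is nonpositive exactly
  because \<open>r \<le> 3\<close>. Integrated, it says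
    \<open>\<integral>(r - 1) d\<mu> \<le> (u(\<X>) - t(\<X>)) / 4 + 4 H\<^sup>2(\<mu>, t) - H\<^sup>2(t, u) / 2\<close>
  for every finite \<open>\<mu>\<close> (\<open>integral_tilt_le_hellinger\<close>). The first term does not depend on \<open>\<mu>\<close>, so it can
  be absorbed into the critical value, and exchanging \<open>t\<close> and \<open>u\<close> replaces \<open>r\<close> by \<open>1 / r\<close>, hence
  \<open>T\<close> by \<open>- T\<close>: the same threshold serves both errors. A further shift \<open>y\<close> of the threshold
  trades one error for the other (\<open>robust_hellinger_test\<close>).

  The theorem is the case \<open>y = (\<eta>\<^sup>2(u) - \<eta>\<^sup>2(t)) / 4\<close>. Dropping \<open>- H\<^sup>2(t, u) / 2\<close> gives the bound
  for all \<open>\<mu>\<close>; if \<open>H(\<mu>, t) \<le> H(t, u) / 4\<close> then \<open>4 H\<^sup>2(\<mu>, t) \<le> H\<^sup>2(t, u) / 4\<close>, which leaves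
  \<open>- H\<^sup>2(t, u) / 4\<close> in the exponent. The constants explain the choice of the two points: taken at
  a fraction \<open>\<theta>\<close> from the ends of the segment, they give the exponent
  \<open>(1 - 2 \<theta>) (2 H\<^sup>2(\<mu>, t) / \<theta> - H\<^sup>2(t, u))\<close>, which at \<open>H(\<mu>, t) = H(t, u) / 4\<close> is smallest for
  \<open>\<theta> = 1/4\<close>.
\<close>

section \<open>Hellinger distance and the tilted likelihood ratio\<close>

lemma finite_measure_sum_measure:
  assumes "sets \<mu>' = sets \<mu>" "finite_measure \<mu>" "finite_measure \<mu>'"
  shows "finite_measure (sum_measure \<mu> \<mu>')"
proof
  have "space \<mu>' = space \<mu>" using assms(1) by (rule sets_eq_imp_space_eq)
  then show "emeasure (sum_measure \<mu> \<mu>') (space (sum_measure \<mu> \<mu>')) \<noteq> \<infinity>"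
    using emeasure_sum_measure[OF assms(1) sets.top]
      finite_measure.emeasure_finite[OF assms(2)] finite_measure.emeasure_finite[OF assms(3)]
    by simp
qed

lemma
  assumes "sets \<mu>' = sets \<mu>" "finite_measure \<mu>" "finite_measure \<mu>'"
  shows density_RN_deriv_sum_measure_left:
      "density (sum_measure \<mu> \<mu>') (RN_deriv (sum_measure \<mu> \<mu>') \<mu>) = \<mu>"
    and density_RN_deriv_sum_measure_right:
      "density (sum_measure \<mu> \<mu>') (RN_deriv (sum_measure \<mu> \<mu>') \<mu>') = \<mu>'"
proof -
  interpret finite_measure "sum_measure \<mu> \<mu>'"
    using assms by (rule finite_measure_sum_measure)
  have ac: "absolutely_continuous (sum_measure \<mu> \<mu>') \<mu>"
    "absolutely_continuous (sum_measure \<mu> \<mu>') \<mu>'"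
    unfolding absolutely_continuous_def
    by (auto intro!: null_setsI simp: assms(1) null_sets_def emeasure_sum_measure[OF assms(1)])
  show "density (sum_measure \<mu> \<mu>') (RN_deriv (sum_measure \<mu> \<mu>') \<mu>) = \<mu>"
    by (rule density_RN_deriv[OF ac(1)]) simp
  show "density (sum_measure \<mu> \<mu>') (RN_deriv (sum_measure \<mu> \<mu>') \<mu>') = \<mu>'"
    by (rule density_RN_deriv[OF ac(2)]) (simp add: assms(1))
qed

text \<open>
  Radon--Nikodym derivatives take values in \<open>[0, \<infinity>]\<close>; for a finite measure the real version,
  in which \<open>\<infinity>\<close> becomes \<open>0\<close>, differs from it only on a null set.
\<close>

lemma density_enn2real:
  assumes F: "F \<in> borel_measurable \<nu>" and fin: "finite_measure (density \<nu> F)"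
  shows "density \<nu> (\<lambda>x. ennreal (enn2real (F x))) = density \<nu> F"
proof -
  have "integral\<^sup>N \<nu> F = emeasure (density \<nu> F) (space \<nu>)"
    using F by (auto simp: emeasure_density intro!: nn_integral_cong)
  then have "integral\<^sup>N \<nu> F \<noteq> \<infinity>"
    using finite_measure.emeasure_finite[OF fin, of "space \<nu>"] by simp
  from nn_integral_PInf_AE[OF F this] show ?thesis
    using F by (intro density_cong) (auto simp: ennreal_enn2real_if elim: eventually_mono)
qed

lemma
  fixes h :: "'a \<Rightarrow> real"
  assumes F: "F \<in> borel_measurable \<nu>" and d: "density \<nu> F = \<mu>" and fin: "finite_measure \<mu>"
    and h: "integrable \<mu> h"
  shows integrable_enn2real_density: "integrable \<nu> (\<lambda>x. enn2real (F x) * h x)"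
    and integral_enn2real_density: "(\<integral>x. enn2real (F x) * h x \<partial>\<nu>) = (\<integral>x. h x \<partial>\<mu>)"
proof -
  have d': "density \<nu> (\<lambda>x. ennreal (enn2real (F x))) = \<mu>"
    using density_enn2real F fin d by blast
  have hm: "h \<in> borel_measurable \<nu>"
    using borel_measurable_integrable[OF h] d by (auto simp: measurable_def)
  show "integrable \<nu> (\<lambda>x. enn2real (F x) * h x)"
    using h integrable_density[OF hm, of "\<lambda>x. enn2real (F x)"] F unfolding d' by simp
  show "(\<integral>x. enn2real (F x) * h x \<partial>\<nu>) = (\<integral>x. h x \<partial>\<mu>)"
    using integral_density[OF hm, of "\<lambda>x. enn2real (F x)"] F unfolding d' by simp
qed

text \<open>
  The left-hand side is a quadratic polynomial in \<open>m\<close> with leading coefficient \<open>r - 3\<close>; the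
  hypothesis on \<open>r\<close> says that it has a double root at \<open>(3 a + b) / 4\<close>.
\<close>

lemma tilting_identity:
  fixes a b m r :: real
  assumes "r * (3 * a + b) = a + 3 * b"
  shows "(r - 1) * m\<^sup>2 - (b\<^sup>2 - a\<^sup>2) / 4 - 2 * (m - a)\<^sup>2 + (a - b)\<^sup>2 / 4
    = (r - 3) * (m - (3 * a + b) / 4)\<^sup>2"
proof -
  have "(r - 3) * (m - (3 * a + b) / 4)\<^sup>2 = (r - 3) * m\<^sup>2
      - m * (r * (3 * a + b) - 3 * (3 * a + b)) / 2
      + (r * (3 * a + b) - 3 * (3 * a + b)) * (3 * a + b) / 16"
    by (simp add: power2_eq_square field_simps)
  also have "\<dots> = (r - 1) * m\<^sup>2 - (b\<^sup>2 - a\<^sup>2) / 4 - 2 * (m - a)\<^sup>2 + (a - b)\<^sup>2 / 4"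
    unfolding assms by (simp add: power2_eq_square field_simps)
  finally show ?thesis by simp
qed

text \<open>
  The measure \<open>\<mu>\<close> may have a part singular to \<open>t + u\<close>, where the ratio \<open>r\<close> is not determined by
  \<open>t\<close> and \<open>u\<close>. It is therefore only assumed to be bounded and to solve
  \<open>r (3 a + b) = a + 3 b\<close>. This equation is homogeneous in \<open>(a, b)\<close>, so it survives the passage
  from densities with respect to \<open>\<rho>\<close> to densities with respect to the dominating measure
  \<open>\<rho> + \<mu>\<close>, and on the singular part (\<open>a = b = 0\<close>) it puts no constraint on \<open>r\<close>.
\<close>

lemma integral_tilt_le_hellinger:
  fixes r :: "'a \<Rightarrow> real"
  assumes fin: "finite_measure \<mu>" "finite_measure t" "finite_measure u" "finite_measure \<rho>"
    and sets: "sets t = sets \<mu>" "sets u = sets \<mu>" "sets \<rho> = sets \<mu>"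
    and p: "p \<in> borel_measurable \<rho>" "density \<rho> p = t"
    and q: "q \<in> borel_measurable \<rho>" "density \<rho> q = u"
    and r: "r \<in> borel_measurable \<rho>" "\<And>x. 0 \<le> r x" "\<And>x. r x \<le> 3"
    and r_eq: "\<And>x. r x * (3 * sqrt (enn2real (p x)) + sqrt (enn2real (q x)))
      = sqrt (enn2real (p x)) + 3 * sqrt (enn2real (q x))"
  shows "(\<integral>x. r x \<partial>\<mu>) - measure \<mu> (space \<mu>) \<le>
    (measure u (space u) - measure t (space t)) / 4 + 4 * hellinger_sq \<mu> t - hellinger_sq t u / 2"
proof -
  define \<nu> where "\<nu> = sum_measure \<rho> \<mu>"
  define s where "s = RN_deriv \<nu> \<rho>"
  define k where "k = RN_deriv \<nu> \<mu>"
  define f where "f x = s x * p x" for x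
  define g where "g x = s x * q x" for x
  define a where "a x = sqrt (enn2real (f x))" for x
  define b where "b x = sqrt (enn2real (g x))" for x
  define m where "m x = sqrt (enn2real (k x))" for x
  interpret \<mu>: finite_measure \<mu> by fact
  interpret t: finite_measure t by fact
  interpret u: finite_measure u by fact
  have sets_\<nu>: "sets \<nu> = sets \<rho>" by (simp add: \<nu>_def)
  have cong: "borel_measurable \<nu> = borel_measurable \<rho>"
    by (rule measurable_cong_sets) (simp_all add: sets_\<nu>)
  have [measurable]: "p \<in> borel_measurable \<nu>" "q \<in> borel_measurable \<nu>" "r \<in> borel_measurable \<nu>"
    using p(1) q(1) r(1) by (simp_all add: cong)
  have [measurable]: "s \<in> borel_measurable \<nu>" "k \<in> borel_measurable \<nu>"
    by (simp_all add: s_def k_def)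
  have [measurable]: "f \<in> borel_measurable \<nu>" "g \<in> borel_measurable \<nu>"
    unfolding f_def[abs_def] g_def[abs_def] by measurable
  have ds: "density \<nu> s = \<rho>" and k: "density \<nu> k = \<mu>"
    unfolding \<nu>_def s_def k_def using sets fin
    by (auto intro!: density_RN_deriv_sum_measure_left density_RN_deriv_sum_measure_right)
  have f: "density \<nu> f = t" and g: "density \<nu> g = u"
    unfolding f_def[abs_def] g_def[abs_def]
    by (simp_all add: density_density_eq[symmetric] ds p q)
  have sq: "(a x)\<^sup>2 = enn2real (f x)" "(b x)\<^sup>2 = enn2real (g x)" "(m x)\<^sup>2 = enn2real (k x)" for x
    by (simp_all add: a_def b_def m_def)
  have meas[measurable]: "a \<in> borel_measurable \<nu>" "b \<in> borel_measurable \<nu>" "m \<in> borel_measurable \<nu>"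
    unfolding a_def[abs_def] b_def[abs_def] m_def[abs_def] by measurable
  have one: "integrable \<nu> (\<lambda>x. (a x)\<^sup>2)" "integrable \<nu> (\<lambda>x. (b x)\<^sup>2)" "integrable \<nu> (\<lambda>x. (m x)\<^sup>2)"
    "(\<integral>x. (a x)\<^sup>2 \<partial>\<nu>) = measure t (space t)" "(\<integral>x. (b x)\<^sup>2 \<partial>\<nu>) = measure u (space u)"
    "(\<integral>x. (m x)\<^sup>2 \<partial>\<nu>) = measure \<mu> (space \<mu>)"
    using integrable_enn2real_density[OF _ f t.finite_measure_axioms, of "\<lambda>_. 1"]
      integrable_enn2real_density[OF _ g u.finite_measure_axioms, of "\<lambda>_. 1"]
      integrable_enn2real_density[OF _ k \<mu>.finite_measure_axioms, of "\<lambda>_. 1"]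
      integral_enn2real_density[OF _ f t.finite_measure_axioms, of "\<lambda>_. 1"]
      integral_enn2real_density[OF _ g u.finite_measure_axioms, of "\<lambda>_. 1"]
      integral_enn2real_density[OF _ k \<mu>.finite_measure_axioms, of "\<lambda>_. 1"]
    by (simp_all add: sq)
  have "integrable \<mu> r"
  proof (rule \<mu>.integrable_const_bound[where B = 3])
    show "r \<in> borel_measurable \<mu>"
      using r(1) measurable_cong_sets[OF sets(3) refl] by auto
    show "AE x in \<mu>. norm (r x) \<le> 3" using r(2,3) by simp
  qed
  from integrable_enn2real_density[OF _ k \<mu>.finite_measure_axioms this]
    integral_enn2real_density[OF _ k \<mu>.finite_measure_axioms this]
  have r_int: "integrable \<nu> (\<lambda>x. (m x)\<^sup>2 * r x)" "(\<integral>x. (m x)\<^sup>2 * r x \<partial>\<nu>) = (\<integral>x. r x \<partial>\<mu>)"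
    by (simp_all add: sq)
  have diff: "integrable \<nu> (\<lambda>x. (c x - d x)\<^sup>2)"
    if "integrable \<nu> (\<lambda>x. (c x)\<^sup>2)" "integrable \<nu> (\<lambda>x. (d x)\<^sup>2)"
      "c \<in> borel_measurable \<nu>" "d \<in> borel_measurable \<nu>" for c d :: "'a \<Rightarrow> real"
  proof (rule Bochner_Integration.integrable_bound)
    show "integrable \<nu> (\<lambda>x. 2 * (c x)\<^sup>2 + 2 * (d x)\<^sup>2)" using that by simp
    show "AE x in \<nu>. norm ((c x - d x)\<^sup>2) \<le> norm (2 * (c x)\<^sup>2 + 2 * (d x)\<^sup>2)"
    proof (rule AE_I2)
      fix x
      have "(c x - d x)\<^sup>2 = 2 * (c x)\<^sup>2 + 2 * (d x)\<^sup>2 - (c x + d x)\<^sup>2"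
        by (simp add: power2_eq_square algebra_simps)
      then have "(c x - d x)\<^sup>2 \<le> 2 * (c x)\<^sup>2 + 2 * (d x)\<^sup>2"
        by simp
      then show "norm ((c x - d x)\<^sup>2) \<le> norm (2 * (c x)\<^sup>2 + 2 * (d x)\<^sup>2)"
        by simp
    qed
  qed (use that in measurable)
  have d_int: "integrable \<nu> (\<lambda>x. (m x - a x)\<^sup>2)" "integrable \<nu> (\<lambda>x. (a x - b x)\<^sup>2)"
    using diff[OF one(3,1) meas(3,1)] diff[OF one(1,2) meas(1,2)] .
  have h: "(\<integral>x. (m x - a x)\<^sup>2 \<partial>\<nu>) = 2 * hellinger_sq \<mu> t"
    "(\<integral>x. (a x - b x)\<^sup>2 \<partial>\<nu>) = 2 * hellinger_sq t u"
    using hellinger_sq_eq[of t \<mu> k \<nu> f] hellinger_sq_eq[of u t f \<nu> g] k f g fin sets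
    by (simp_all add: a_def b_def m_def)
  have pw: "(m x)\<^sup>2 * r x - (m x)\<^sup>2
      \<le> (b x)\<^sup>2 / 4 - (a x)\<^sup>2 / 4 + 2 * (m x - a x)\<^sup>2 - (a x - b x)\<^sup>2 / 4" for x
  proof -
    \<comment> \<open>With \<open>s = d\<rho>/d\<nu>\<close>, the equation for \<open>r\<close> is multiplied by \<open>\<surd>s\<close>.\<close>
    have "r x * (3 * a x + b x) = a x + 3 * b x"
      using arg_cong[OF r_eq[of x], of "\<lambda>y. sqrt (enn2real (s x)) * y"]
      by (simp add: a_def b_def f_def g_def enn2real_mult real_sqrt_mult algebra_simps)
    from tilting_identity[OF this, of "m x"]
    have "(r x - 1) * (m x)\<^sup>2 - ((b x)\<^sup>2 - (a x)\<^sup>2) / 4 - 2 * (m x - a x)\<^sup>2 + (a x - b x)\<^sup>2 / 4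
      \<le> 0"
      using r(3)[of x] by (simp add: mult_nonpos_nonneg)
    then show ?thesis by (simp add: algebra_simps diff_divide_distrib)
  qed
  have "(\<integral>x. r x \<partial>\<mu>) - measure \<mu> (space \<mu>) = (\<integral>x. (m x)\<^sup>2 * r x - (m x)\<^sup>2 \<partial>\<nu>)"
    using r_int one by simp
  also have "\<dots> \<le> (\<integral>x. (b x)\<^sup>2 / 4 - (a x)\<^sup>2 / 4 + 2 * (m x - a x)\<^sup>2 - (a x - b x)\<^sup>2 / 4 \<partial>\<nu>)"
    using pw r_int one d_int by (intro integral_mono) auto
  also have "\<dots> = (measure u (space u) - measure t (space t)) / 4 + 4 * hellinger_sq \<mu> t
      - hellinger_sq t u / 2"
    using one d_int h by (simp add: diff_divide_distrib)
  finally show ?thesis .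
qed

section \<open>Linear statistics of a Poisson process\<close>

lemma measurable_count_point_configs:
  assumes "A \<in> sets M"
  shows "(\<lambda>X. size (filter_mset (\<lambda>x. x \<in> A) X)) \<in> measurable (point_configs M) (count_space UNIV)"
proof -
  have "(\<lambda>X. size (filter_mset (\<lambda>x. x \<in> A) X)) -` {k} \<inter> space (point_configs M)
      \<in> sets (point_configs M)" for k
  proof -
    have "(\<lambda>X. size (filter_mset (\<lambda>x. x \<in> A) X)) -` {k} \<inter> space (point_configs M)
      = {X. set_mset X \<subseteq> space M \<and> size (filter_mset (\<lambda>x. x \<in> A) X) = k}"
      by (auto simp: space_point_configs)
    also have "\<dots> \<in> sets (point_configs M)"
      unfolding point_configs_def using assms by (intro in_measure_of) auto
    finally show ?thesis .
  qed
  then show ?thesis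
    by (subst measurable_count_space_eq_countable) auto
qed

text \<open>
  The sigma-algebra on configurations is generated by counting variables, which are the case of
  indicator functions; the general case follows by approximation with simple functions.
\<close>

lemma borel_measurable_sum_mset_ennreal:
  fixes f :: "'a \<Rightarrow> ennreal"
  assumes "f \<in> borel_measurable M"
  shows "(\<lambda>X. \<Sum>x\<in>#X. f x) \<in> borel_measurable (point_configs M)"
  using assms
proof (induction rule: borel_measurable_induct)
  case (cong f g)
  have "(\<Sum>x\<in>#X. f x) = (\<Sum>x\<in>#X. g x)" if "X \<in> space (point_configs M)" for X
  proof -
    have "f x = g x" if "x \<in># X" for x
      using that \<open>X \<in> _\<close> cong(3) unfolding space_point_configs by blast
    then show ?thesis by (metis image_mset_cong)
  qed
  then have "(\<lambda>X. \<Sum>x\<in>#X. f x) \<in> borel_measurable (point_configs M)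
      \<longleftrightarrow> (\<lambda>X. \<Sum>x\<in>#X. g x) \<in> borel_measurable (point_configs M)"
    by (rule measurable_cong)
  then show ?case using cong(4) by simp
next
  case (set A)
  have "(\<Sum>x\<in>#X. indicator A x) = (of_nat (size (filter_mset (\<lambda>x. x \<in> A) X)) :: ennreal)" for X
    by (induction X) auto
  then show ?case
    using measurable_compose[OF measurable_count_point_configs[OF set], of of_nat borel] by simp
next
  case (mult f c)
  then show ?case by (simp add: sum_mset_distrib_left[symmetric])
next
  case (add f g)
  then show ?case by (simp add: sum_mset.distrib)
next
  case (seq U)
  have "(\<Sum>x\<in>#X. SUP i. U i x) = (SUP i. \<Sum>x\<in>#X. U i x)" for X
  proof (induction X)
    case (add y X)
    have "incseq (\<lambda>i. \<Sum>x\<in>#X. U i x)"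
      using seq(3) by (auto simp: mono_def le_fun_def intro!: sum_mset_mono)
    moreover have "incseq (\<lambda>i. U i y)" using seq(3) by (auto simp: mono_def le_fun_def)
    ultimately show ?case using add by (simp add: ennreal_SUP_add)
  qed simp
  then have "(\<lambda>X. \<Sum>x\<in>#X. (SUP i. U i) x) = (\<lambda>X. SUP i. \<Sum>x\<in>#X. U i x)"
    unfolding SUP_apply by simp
  then show ?case using seq by simp
qed

lemma borel_measurable_sum_mset_real:
  fixes f :: "'a \<Rightarrow> real"
  assumes [measurable]: "f \<in> borel_measurable M"
  shows "(\<lambda>X. \<Sum>x\<in>#X. f x) \<in> borel_measurable (point_configs M)"
proof -
  have fin: "(\<Sum>x\<in>#X. ennreal (h x)) < top" for h :: "'a \<Rightarrow> real" and X
    by (induction X) auto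
  have "(\<Sum>x\<in>#X. f x)
      = enn2real (\<Sum>x\<in>#X. ennreal (f x)) - enn2real (\<Sum>x\<in>#X. ennreal (- f x))" for X
  proof (induction X)
    case (add y X)
    have "f y = enn2real (ennreal (f y)) - enn2real (ennreal (- f y))"
      by (cases "0 \<le> f y") (auto simp: ennreal_neg)
    then show ?case using add fin by (simp add: enn2real_plus)
  qed simp
  moreover have "(\<lambda>X. \<Sum>x\<in>#X. ennreal (f x)) \<in> borel_measurable (point_configs M)"
    "(\<lambda>X. \<Sum>x\<in>#X. ennreal (- f x)) \<in> borel_measurable (point_configs M)"
    by (intro borel_measurable_sum_mset_ennreal; measurable)+
  ultimately show ?thesis by simp
qed

text \<open>
  The total mass is bounded by one instead of equal to one because normalizing the zero measure
  yields the zero measure.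
\<close>

lemma measurable_poisson_kernel:
  fixes \<mu> :: "'a measure" and p :: "nat pmf"
  assumes "sets P = sets \<mu>" "emeasure P (space P) \<le> 1"
  shows "(\<lambda>n. distr (PiM {..<n} (\<lambda>_. P)) (point_configs \<mu>) (\<lambda>\<omega>. mset (map \<omega> [0..<n])))
    \<in> measurable (measure_pmf p) (subprob_algebra (point_configs \<mu>))"
proof -
  interpret finite_measure P
    using assms(2) by (intro finite_measureI) (auto simp: top_unique)
  interpret product_sigma_finite "\<lambda>_::nat. P" by standard
  have "subprob_space (distr (PiM {..<n} (\<lambda>_. P)) (point_configs \<mu>) (\<lambda>\<omega>. mset (map \<omega> [0..<n])))"
    (is "subprob_space ?K") for n
  proof (rule subprob_spaceI)
    have meas: "(\<lambda>\<omega>. mset (map \<omega> [0..<n])) \<in> measurable (PiM {..<n} (\<lambda>_. P)) (point_configs \<mu>)"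
      by (rule measurable_point_configs_mset[OF assms(1)])
    have "emeasure ?K (space ?K) = emeasure (PiM {..<n} (\<lambda>_. P)) (space (PiM {..<n} (\<lambda>_. P)))"
      unfolding space_distr emeasure_distr[OF meas sets.top]
      using measurable_space[OF meas] by (intro arg_cong2[where f = emeasure]) auto
    also have "\<dots> = (\<Prod>i<n. emeasure P (space P))"
      unfolding space_PiM by (rule emeasure_PiM) auto
    also have "\<dots> \<le> 1"
      using assms(2) by (simp add: power_le_one)
    finally show "emeasure ?K (space ?K) \<le> 1" .
    show "space ?K \<noteq> {}"
      by (auto simp: space_point_configs intro!: exI[of _ "{#}"])
  qed
  then show ?thesis by (auto simp: space_subprob_algebra)
qed

text \<open>
  Given \<open>N = n\<close> the points are independent, so the conditional expectation is the \<open>n\<close>-th power of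
  the mean of \<open>e\<^sup>\<phi>\<close> under the normalized measure. Averaging over the Poisson variable \<open>N\<close> sums the
  exponential series.
\<close>

lemma poisson_process_exp_moment:
  fixes \<phi> :: "'a \<Rightarrow> real"
  assumes fin: "finite_measure \<mu>"
    and \<phi>: "\<phi> \<in> borel_measurable \<mu>" and int: "integrable \<mu> (\<lambda>x. exp (\<phi> x))"
  shows "(\<integral>\<^sup>+X. ennreal (exp (\<Sum>x\<in>#X. \<phi> x)) \<partial>poisson_process \<mu>)
    = ennreal (exp ((\<integral>x. exp (\<phi> x) \<partial>\<mu>) - measure \<mu> (space \<mu>)))"
proof -
  interpret finite_measure \<mu> by fact
  define c where "c = measure \<mu> (space \<mu>)"
  define a where "a = (\<integral>x. exp (\<phi> x) \<partial>\<mu>)"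
  define P where "P = scale_measure (1 / emeasure \<mu> (space \<mu>)) \<mu>"
  define K where "K n = distr (PiM {..<n} (\<lambda>_. P)) (point_configs \<mu>) (\<lambda>\<omega>. mset (map \<omega> [0..<n]))"
    for n :: nat
  have em: "emeasure \<mu> (space \<mu>) = ennreal c"
    by (simp add: c_def emeasure_eq_measure)
  have c: "0 \<le> c" by (simp add: c_def)
  have sets_P: "sets P = sets \<mu>" by (simp add: P_def)
  have [measurable]: "\<phi> \<in> borel_measurable P"
    using \<phi> measurable_cong_sets[OF sets_P refl] by blast
  have em_P: "emeasure P (space P) \<le> 1"
    using c by (cases "c = 0")
      (simp_all add: P_def space_scale_measure em ennreal_divide_times divide_ennreal ennreal_divide_self)
  interpret P: finite_measure P
    using em_P by (intro finite_measureI) (auto simp: top_unique)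
  interpret product_sigma_finite "\<lambda>_::nat. P" by standard
  have stat[measurable]: "(\<lambda>X. \<Sum>x\<in>#X. \<phi> x) \<in> borel_measurable (point_configs \<mu>)"
    by (rule borel_measurable_sum_mset_real[OF \<phi>])
  define z where "z = (\<integral>\<^sup>+x. ennreal (exp (\<phi> x)) \<partial>P)"
  have K_int: "(\<integral>\<^sup>+X. ennreal (exp (\<Sum>x\<in>#X. \<phi> x)) \<partial>K n) = z ^ n" for n
  proof -
    have "(\<integral>\<^sup>+X. ennreal (exp (\<Sum>x\<in>#X. \<phi> x)) \<partial>K n)
        = (\<integral>\<^sup>+\<omega>. ennreal (exp (\<Sum>x\<in>#mset (map \<omega> [0..<n]). \<phi> x)) \<partial>PiM {..<n} (\<lambda>_. P))"
      unfolding K_def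
      by (rule nn_integral_distr[OF measurable_point_configs_mset[OF sets_P]]) measurable
    also have "\<dots> = (\<integral>\<^sup>+\<omega>. (\<Prod>i<n. ennreal (exp (\<phi> (\<omega> i)))) \<partial>PiM {..<n} (\<lambda>_. P))"
    proof (rule nn_integral_cong)
      fix \<omega>
      have "(\<Sum>x\<in>#mset (map \<omega> [0..<n]). \<phi> x) = (\<Sum>i<n. \<phi> (\<omega> i))"
        by (induction n) auto
      then show "ennreal (exp (\<Sum>x\<in>#mset (map \<omega> [0..<n]). \<phi> x)) = (\<Prod>i<n. ennreal (exp (\<phi> (\<omega> i))))"
        by (simp add: exp_sum prod_ennreal)
    qed
    also have "\<dots> = (\<Prod>i<n. z)"
      unfolding z_def by (rule product_nn_integral_prod) auto
    finally show ?thesis by simp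
  qed
  have "(\<integral>\<^sup>+X. ennreal (exp (\<Sum>x\<in>#X. \<phi> x)) \<partial>poisson_process \<mu>)
      = (\<integral>\<^sup>+n. z ^ n \<partial>measure_pmf (poisson_nat c))"
    unfolding poisson_process_def P_def[symmetric] c_def[symmetric] K_int[symmetric] K_def[abs_def]
    by (rule nn_integral_bind[OF _ measurable_poisson_kernel[OF sets_P em_P]]) measurable
  also have "\<dots> = ennreal (exp (a - c))"
  proof (cases "c = 0")
    case True
    \<comment> \<open>The zero measure: there are no points, and both exponents vanish.\<close>
    then have "emeasure \<mu> (space \<mu>) = 0" using em by simp
    then have "AE x in \<mu>. exp (\<phi> x) = 0"
      by (intro AE_I[of _ _ "space \<mu>"]) auto
    then have "a = 0" unfolding a_def by (rule integral_eq_zero_AE)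
    then show ?thesis using True by (simp add: poisson_nat_def)
  next
    case False
    then have pos: "0 < c" using c by simp
    have "z = ennreal (1 / c) * ennreal a"
      using \<phi> int pos unfolding z_def P_def a_def em
      by (simp add: nn_integral_scale_measure nn_integral_eq_integral ennreal_1[symmetric]
          divide_ennreal del: ennreal_1)
    then have z: "z = ennreal (a / c)"
      using pos by (simp add: ennreal_mult'[symmetric])
    have a: "0 \<le> a" unfolding a_def by simp
    have "(\<integral>\<^sup>+n. z ^ n \<partial>measure_pmf (poisson_nat c))
        = (\<Sum>n. ennreal (c ^ n / fact n * exp (- c)) * z ^ n)"
      using pos by (simp add: poisson_nat_def nn_integral_measure_pmf nn_integral_count_space_nat)
    also have "\<dots> = (\<Sum>n. ennreal (exp (- c) * (a ^ n /\<^sub>R fact n)))"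
      using pos a by (intro arg_cong[of _ _ suminf] ext)
        (simp add: z ennreal_power ennreal_mult'[symmetric] power_divide field_simps)
    also have "\<dots> = ennreal (exp (- c) * exp a)"
      using a by (intro suminf_ennreal_eq sums_mult exp_converges) simp
    finally show ?thesis by (simp add: exp_diff exp_minus field_simps)
  qed
  finally show ?thesis unfolding a_def c_def .
qed

text \<open>
  Markov's inequality for \<open>exp (\<Sum>\<phi>)\<close>.
\<close>

lemma poisson_process_Chernoff:
  fixes \<phi> :: "'a \<Rightarrow> real"
  assumes fin: "finite_measure \<mu>"
    and \<phi>: "\<phi> \<in> borel_measurable \<mu>" and int: "integrable \<mu> (\<lambda>x. exp (\<phi> x))"
  shows "\<P>(X in poisson_process \<mu>. c \<le> (\<Sum>x\<in>#X. \<phi> x))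
    \<le> exp ((\<integral>x. exp (\<phi> x) \<partial>\<mu>) - measure \<mu> (space \<mu>) - c)"
proof -
  interpret prob_space "poisson_process \<mu>"
    using fin by (rule prob_space_poisson_process)
  have [measurable]: "(\<lambda>X. \<Sum>x\<in>#X. \<phi> x) \<in> borel_measurable (poisson_process \<mu>)"
    using borel_measurable_sum_mset_real[OF \<phi>] measurable_cong_sets[OF sets_poisson_process refl]
    by blast
  let ?A = "{X \<in> space (poisson_process \<mu>). c \<le> (\<Sum>x\<in>#X. \<phi> x)}"
  have "emeasure (poisson_process \<mu>) ?A = (\<integral>\<^sup>+X. indicator ?A X \<partial>poisson_process \<mu>)"
    by simp
  also have "\<dots> \<le> (\<integral>\<^sup>+X. ennreal (exp (- c)) * ennreal (exp (\<Sum>x\<in>#X. \<phi> x)) \<partial>poisson_process \<mu>)"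
    by (intro nn_integral_mono)
      (auto simp: indicator_def ennreal_mult'[symmetric] exp_add[symmetric])
  also have "\<dots> = ennreal (exp (- c)) * (\<integral>\<^sup>+X. ennreal (exp (\<Sum>x\<in>#X. \<phi> x)) \<partial>poisson_process \<mu>)"
    by (rule nn_integral_cmult) measurable
  also have "\<dots> = ennreal (exp ((\<integral>x. exp (\<phi> x) \<partial>\<mu>) - measure \<mu> (space \<mu>) - c))"
    unfolding poisson_process_exp_moment[OF assms]
    by (simp add: ennreal_mult'[symmetric] exp_add[symmetric] algebra_simps)
  finally show ?thesis by (simp add: emeasure_eq_measure)
qed

section \<open>The robust test\<close>

text \<open>
  The arguments are the densities of \<open>t\<close> and \<open>u\<close> at a point. Where both vanish the observation
  carries no information, and the value \<open>1\<close> keeps the symmetry \<open>inverse_tilt\<close>.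
\<close>

definition tilt :: "real \<Rightarrow> real \<Rightarrow> real" where
  "tilt x y = (if sqrt x + sqrt y = 0 then 1 else (sqrt x + 3 * sqrt y) / (3 * sqrt x + sqrt y))"

lemma
  assumes "0 \<le> x" "0 \<le> y"
  shows tilt_pos: "0 < tilt x y"
    and tilt_le_3: "tilt x y \<le> 3"
    and inverse_tilt: "inverse (tilt x y) = tilt y x"
    and tilt_eq: "tilt x y * (3 * sqrt x + sqrt y) = sqrt x + 3 * sqrt y"
proof -
  define a b where ab: "a = sqrt x" "b = sqrt y"
  have nn: "0 \<le> a" "0 \<le> b" using assms by (simp_all add: ab)
  have eq: "tilt x y = (if a + b = 0 then 1 else (a + 3 * b) / (3 * a + b))"
    "tilt y x = (if a + b = 0 then 1 else (b + 3 * a) / (3 * b + a))"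
    by (simp_all add: tilt_def ab add.commute)
  have cases: "a = 0 \<and> b = 0 \<or> a + b \<noteq> 0 \<and> 3 * a + b > 0 \<and> a + 3 * b > 0"
    using nn by auto
  show "0 < tilt x y" "tilt x y \<le> 3" "inverse (tilt x y) = tilt y x"
    "tilt x y * (3 * sqrt x + sqrt y) = sqrt x + 3 * sqrt y"
    unfolding eq ab[symmetric] using cases nn by (auto simp: divide_simps add.commute)
qed

lemma Q_dens_subset_Q_plus: "Q_dens M \<subseteq> Q_plus M"
proof
  fix t assume "t \<in> Q_dens M"
  then obtain f :: "'a \<Rightarrow> real" where f: "integrable M f" "\<forall>x\<in>space M. 0 \<le> f x"
    and t: "t = density M (\<lambda>x. ennreal (f x))"
    unfolding Q_dens_def by auto
  have "emeasure t (space t) = (\<integral>\<^sup>+x. ennreal (f x) \<partial>M)"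
    using f unfolding t by (auto simp: emeasure_density intro!: nn_integral_cong)
  also have "\<dots> \<noteq> \<infinity>"
    using f by (subst nn_integral_eq_integral) auto
  finally show "t \<in> Q_plus M"
    unfolding Q_plus_def by (auto intro: finite_measureI simp: t)
qed

text \<open>
  The parameter \<open>y\<close> shifts the critical value: a large \<open>y\<close> makes the choice of \<open>u\<close> harder. Up to
  \<open>y\<close>, both error exponents stay below a negative multiple of \<open>H\<^sup>2(t, u)\<close> on a Hellinger ball around
  the true point, also for measures \<open>\<mu>\<close> in that ball that are singular to \<open>t + u\<close> in part.
\<close>

lemma robust_hellinger_test:
  fixes M :: "'a measure" and y :: real
  assumes t: "t \<in> Q_plus M" and u: "u \<in> Q_plus M" and "t \<noteq> u"
  obtains \<psi> where "is_test M t u \<psi>"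
    and "\<And>\<mu>. \<mu> \<in> Q_plus M \<Longrightarrow> \<P>(X in poisson_process \<mu>. \<psi> X = u)
      \<le> exp (4 * (hellinger \<mu> t)\<^sup>2 - (hellinger t u)\<^sup>2 / 2 - y)"
    and "\<And>\<mu>. \<mu> \<in> Q_plus M \<Longrightarrow> \<P>(X in poisson_process \<mu>. \<psi> X = t)
      \<le> exp (4 * (hellinger \<mu> u)\<^sup>2 - (hellinger t u)\<^sup>2 / 2 + y)"
proof -
  have sets: "sets t = sets M" "sets u = sets M" and fin: "finite_measure t" "finite_measure u"
    using t u by (auto simp: Q_plus_def)
  define \<rho> where "\<rho> = sum_measure t u"
  define p q where pq: "p = RN_deriv \<rho> t" "q = RN_deriv \<rho> u"
  define r where "r x = tilt (enn2real (p x)) (enn2real (q x))" for x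
  define r' where "r' x = tilt (enn2real (q x)) (enn2real (p x))" for x
  have \<rho>: "finite_measure \<rho>" "sets \<rho> = sets M"
    unfolding \<rho>_def using sets fin by (simp_all add: finite_measure_sum_measure)
  have p: "p \<in> borel_measurable \<rho>" "density \<rho> p = t" and q: "q \<in> borel_measurable \<rho>" "density \<rho> q = u"
    unfolding pq \<rho>_def using sets fin
    by (simp_all add: density_RN_deriv_sum_measure_left density_RN_deriv_sum_measure_right)
  note [measurable] = p(1) q(1)
  have r_meas: "r \<in> borel_measurable \<rho>" "r' \<in> borel_measurable \<rho>"
    unfolding r_def[abs_def] r'_def[abs_def] tilt_def by measurable
  have r: "0 < r x" "r x \<le> 3" "0 < r' x" "r' x \<le> 3" "r' x = inverse (r x)" for x
    by (simp_all add: r_def r'_def tilt_pos tilt_le_3 inverse_tilt)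
  define T where "T X = (\<Sum>x\<in>#X. ln (r x))" for X
  \<comment> \<open>\<open>k\<close> is the part of the exponent that does not depend on \<open>\<mu>\<close>; it changes sign when \<open>t\<close> and
    \<open>u\<close> are exchanged, as does \<open>T\<close>.\<close>
  define k where "k = (measure u (space u) - measure t (space t)) / 4"
  define \<psi> where "\<psi> X = (if k + y \<le> T X then u else t)" for X
  have \<psi>_u: "\<psi> X = u \<longleftrightarrow> k + y \<le> T X" for X
    using \<open>t \<noteq> u\<close> by (simp add: \<psi>_def)
  have lnr: "(\<lambda>x. ln (r x)) \<in> borel_measurable M" "(\<lambda>x. - ln (r x)) \<in> borel_measurable M"
    using r_meas unfolding measurable_cong_sets[OF \<rho>(2) refl] by measurable
  have T: "T \<in> borel_measurable (point_configs M)"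
    unfolding T_def[abs_def] by (rule borel_measurable_sum_mset_real[OF lnr(1)])
  have hell: "hellinger \<mu> \<mu>' ^ 2 = hellinger_sq \<mu> \<mu>'" for \<mu> \<mu>' :: "'a measure"
    unfolding hellinger_def hellinger_sq_def Let_def by (subst real_sqrt_pow2) auto
  have comm: "hellinger_sq u t = hellinger_sq t u"
    using hellinger_sq_eq[of u t p \<rho> q] hellinger_sq_eq[of t u q \<rho> p] p q sets fin
    by (simp add: power2_commute)
  show thesis
  proof
    show "is_test M t u \<psi>"
      unfolding is_test_def \<psi>_def[abs_def] using T by measurable
  next
    fix \<mu> assume \<mu>: "\<mu> \<in> Q_plus M"
    then have sets_\<mu>: "sets \<mu> = sets M" and fin_\<mu>: "finite_measure \<mu>" by (auto simp: Q_plus_def)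
    interpret \<mu>: finite_measure \<mu> by fact
    have lnr_\<mu>: "(\<lambda>x. ln (r x)) \<in> borel_measurable \<mu>" "(\<lambda>x. - ln (r x)) \<in> borel_measurable \<mu>"
      and r_\<mu>: "r \<in> borel_measurable \<mu>" "r' \<in> borel_measurable \<mu>"
      using lnr r_meas by (simp_all add: measurable_cong_sets[OF sets_\<mu> refl]
          measurable_cong_sets[OF \<rho>(2) refl])
    have exp_ln: "exp (ln (r x)) = r x" "exp (- ln (r x)) = r' x" for x
      using r[of x] by (simp_all add: exp_minus)
    have int: "integrable \<mu> r" "integrable \<mu> r'"
      using r r_\<mu> by (auto intro!: \<mu>.integrable_const_bound[where B = 3] simp: less_imp_le)
    have "\<P>(X in poisson_process \<mu>. \<psi> X = u) = \<P>(X in poisson_process \<mu>. k + y \<le> (\<Sum>x\<in>#X. ln (r x)))"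
      unfolding \<psi>_u T_def ..
    also have "\<dots> \<le> exp ((\<integral>x. r x \<partial>\<mu>) - measure \<mu> (space \<mu>) - (k + y))"
      using poisson_process_Chernoff[OF fin_\<mu> lnr_\<mu>(1)] int by (simp add: exp_ln)
    also have "\<dots> \<le> exp (4 * (hellinger \<mu> t)\<^sup>2 - (hellinger t u)\<^sup>2 / 2 - y)"
      using integral_tilt_le_hellinger[OF fin_\<mu> fin \<rho>(1) _ _ _ p q r_meas(1)] sets sets_\<mu> \<rho>(2) r
      by (simp add: hell k_def r_def tilt_eq less_imp_le)
    finally show "\<P>(X in poisson_process \<mu>. \<psi> X = u)
      \<le> exp (4 * (hellinger \<mu> t)\<^sup>2 - (hellinger t u)\<^sup>2 / 2 - y)" .
    interpret pp: prob_space "poisson_process \<mu>"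
      using fin_\<mu> by (rule prob_space_poisson_process)
    have T': "(\<lambda>X. - T X) = (\<lambda>X. \<Sum>x\<in>#X. - ln (r x))"
    proof
      fix X show "- T X = (\<Sum>x\<in>#X. - ln (r x))" unfolding T_def by (induction X) auto
    qed
    have [measurable]: "(\<lambda>X. - T X) \<in> borel_measurable (poisson_process \<mu>)"
      using borel_measurable_sum_mset_real[OF lnr_\<mu>(2)]
        measurable_cong_sets[OF sets_poisson_process refl] unfolding T' by blast
    have "\<P>(X in poisson_process \<mu>. \<psi> X = t) \<le> \<P>(X in poisson_process \<mu>. - k - y \<le> - T X)"
      using \<open>t \<noteq> u\<close> by (intro pp.finite_measure_mono) (auto simp: \<psi>_def)
    also have "\<dots> \<le> exp ((\<integral>x. r' x \<partial>\<mu>) - measure \<mu> (space \<mu>) - (- k - y))"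
      using poisson_process_Chernoff[OF fin_\<mu> lnr_\<mu>(2), of "- k - y"] int fun_cong[OF T']
      by (simp add: exp_ln)
    also have "\<dots> \<le> exp (4 * (hellinger \<mu> u)\<^sup>2 - (hellinger t u)\<^sup>2 / 2 + y)"
      using integral_tilt_le_hellinger[OF fin_\<mu> fin(2,1) \<rho>(1) _ _ _ q p r_meas(2)] sets sets_\<mu> \<rho>(2) r
      by (simp add: hell comm k_def r'_def tilt_eq less_imp_le diff_divide_distrib)
    finally show "\<P>(X in poisson_process \<mu>. \<psi> X = t)
      \<le> exp (4 * (hellinger \<mu> u)\<^sup>2 - (hellinger t u)\<^sup>2 / 2 + y)" .
  qed
qed

theorem proposition1:
  fixes lam :: "'a measure"
    and I :: "'i set"
    and S :: "'i \<Rightarrow> 'a measure set"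
    and \<eta> D :: "'i \<Rightarrow> real"
    and B \<Sigma> :: real
    and t u :: "'a measure"
  assumes "countable I"
    and "\<And>m. m \<in> I \<Longrightarrow> D_model (Q_dens lam) hellinger (S m) (\<eta> m) (D m) B"
    and "\<And>m. m \<in> I \<Longrightarrow> D m \<ge> 1 / 2"
    and "\<And>m. m \<in> I \<Longrightarrow> (\<eta> m)\<^sup>2 \<ge> 84 * D m / 5"
    and "((\<lambda>m. exp (- (\<eta> m)\<^sup>2 / 84)) has_sum \<Sigma>) I"
    and "t \<in> (\<Union>m\<in>I. S m)"
    and "u \<in> (\<Union>m\<in>I. S m)"
    and "t \<noteq> u"
  shows "\<exists>\<psi>. is_test lam t u \<psi> \<and>
    (SUP \<mu>\<in>{\<mu>\<in>Q_plus lam. hellinger \<mu> t \<le> hellinger t u / 4}.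
        \<P>(X in poisson_process \<mu>. \<psi> X = u))
      \<le> exp (- ((hellinger t u)\<^sup>2 - (eta_at I S \<eta> t)\<^sup>2 + (eta_at I S \<eta> u)\<^sup>2) / 4) \<and>
    (SUP \<mu>\<in>{\<mu>\<in>Q_plus lam. hellinger \<mu> u \<le> hellinger t u / 4}.
        \<P>(X in poisson_process \<mu>. \<psi> X = t))
      \<le> exp (- ((hellinger t u)\<^sup>2 - (eta_at I S \<eta> u)\<^sup>2 + (eta_at I S \<eta> t)\<^sup>2) / 4) \<and>
    (\<forall>\<mu>\<in>Q_plus lam.
        \<P>(X in poisson_process \<mu>. \<psi> X = u)
      \<le> exp ((16 * (hellinger \<mu> t)\<^sup>2 + (eta_at I S \<eta> t)\<^sup>2 - (eta_at I S \<eta> u)\<^sup>2) / 4))"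
proof -
  have Q: "t \<in> Q_plus lam" "u \<in> Q_plus lam"
    using assms(2,6,7) Q_dens_subset_Q_plus unfolding D_model_def by blast+
  define y where "y = ((eta_at I S \<eta> u)\<^sup>2 - (eta_at I S \<eta> t)\<^sup>2) / 4"
  from robust_hellinger_test[OF Q assms(8), of y] obtain \<psi> where test: "is_test lam t u \<psi>"
    and err_u: "\<And>\<mu>. \<mu> \<in> Q_plus lam \<Longrightarrow> \<P>(X in poisson_process \<mu>. \<psi> X = u)
      \<le> exp (4 * (hellinger \<mu> t)\<^sup>2 - (hellinger t u)\<^sup>2 / 2 - y)"
    and err_t: "\<And>\<mu>. \<mu> \<in> Q_plus lam \<Longrightarrow> \<P>(X in poisson_process \<mu>. \<psi> X = t)
      \<le> exp (4 * (hellinger \<mu> u)\<^sup>2 - (hellinger t u)\<^sup>2 / 2 + y)"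
    by blast
  have nonneg: "0 \<le> hellinger \<mu> \<mu>'" and self: "hellinger \<mu> \<mu> = 0" for \<mu> \<mu>' :: "'a measure"
    by (simp_all add: hellinger_def hellinger_sq_def Let_def)
  have near: "16 * (hellinger \<mu> v)\<^sup>2 \<le> (hellinger t u)\<^sup>2"
    if "hellinger \<mu> v \<le> hellinger t u / 4" for \<mu> v :: "'a measure"
    using power_mono[OF that nonneg, of 2] by (simp add: power_divide)
  show ?thesis
  proof (intro exI[of _ \<psi>] conjI ballI)
    show "is_test lam t u \<psi>" by (fact test)
    show "(SUP \<mu>\<in>{\<mu>\<in>Q_plus lam. hellinger \<mu> t \<le> hellinger t u / 4}.
          \<P>(X in poisson_process \<mu>. \<psi> X = u))
        \<le> exp (- ((hellinger t u)\<^sup>2 - (eta_at I S \<eta> t)\<^sup>2 + (eta_at I S \<eta> u)\<^sup>2) / 4)"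
    proof (rule cSUP_least)
      show "{\<mu>\<in>Q_plus lam. hellinger \<mu> t \<le> hellinger t u / 4} \<noteq> {}"
        using Q(1) self[of t] nonneg[of t u] by auto
      fix \<mu> assume \<mu>: "\<mu> \<in> {\<mu>\<in>Q_plus lam. hellinger \<mu> t \<le> hellinger t u / 4}"
      have "4 * (hellinger \<mu> t)\<^sup>2 - (hellinger t u)\<^sup>2 / 2 - y
          \<le> - ((hellinger t u)\<^sup>2 - (eta_at I S \<eta> t)\<^sup>2 + (eta_at I S \<eta> u)\<^sup>2) / 4"
        using near[of \<mu> t] \<mu> by (simp add: y_def field_simps)
      then show "\<P>(X in poisson_process \<mu>. \<psi> X = u)
          \<le> exp (- ((hellinger t u)\<^sup>2 - (eta_at I S \<eta> t)\<^sup>2 + (eta_at I S \<eta> u)\<^sup>2) / 4)"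
        using err_u[of \<mu>] \<mu> order_trans exp_le_cancel_iff by blast
    qed
    show "(SUP \<mu>\<in>{\<mu>\<in>Q_plus lam. hellinger \<mu> u \<le> hellinger t u / 4}.
          \<P>(X in poisson_process \<mu>. \<psi> X = t))
        \<le> exp (- ((hellinger t u)\<^sup>2 - (eta_at I S \<eta> u)\<^sup>2 + (eta_at I S \<eta> t)\<^sup>2) / 4)"
    proof (rule cSUP_least)
      show "{\<mu>\<in>Q_plus lam. hellinger \<mu> u \<le> hellinger t u / 4} \<noteq> {}"
        using Q(2) self[of u] nonneg[of t u] by auto
      fix \<mu> assume \<mu>: "\<mu> \<in> {\<mu>\<in>Q_plus lam. hellinger \<mu> u \<le> hellinger t u / 4}"
      have "4 * (hellinger \<mu> u)\<^sup>2 - (hellinger t u)\<^sup>2 / 2 + y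
          \<le> - ((hellinger t u)\<^sup>2 - (eta_at I S \<eta> u)\<^sup>2 + (eta_at I S \<eta> t)\<^sup>2) / 4"
        using near[of \<mu> u] \<mu> by (simp add: y_def field_simps)
      then show "\<P>(X in poisson_process \<mu>. \<psi> X = t)
          \<le> exp (- ((hellinger t u)\<^sup>2 - (eta_at I S \<eta> u)\<^sup>2 + (eta_at I S \<eta> t)\<^sup>2) / 4)"
        using err_t[of \<mu>] \<mu> order_trans exp_le_cancel_iff by blast
    qed
  next
    fix \<mu> assume \<mu>: "\<mu> \<in> Q_plus lam"
    have "4 * (hellinger \<mu> t)\<^sup>2 - (hellinger t u)\<^sup>2 / 2 - y
        \<le> (16 * (hellinger \<mu> t)\<^sup>2 + (eta_at I S \<eta> t)\<^sup>2 - (eta_at I S \<eta> u)\<^sup>2) / 4"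
      by (simp add: y_def field_simps)
    then show "\<P>(X in poisson_process \<mu>. \<psi> X = u)
        \<le> exp ((16 * (hellinger \<mu> t)\<^sup>2 + (eta_at I S \<eta> t)\<^sup>2 - (eta_at I S \<eta> u)\<^sup>2) / 4)"
      using err_u[OF \<mu>] order_trans exp_le_cancel_iff by blast
  qed
qed

end
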